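(* For every finite simple graph $G$ and every $r\ge 2$, there exists an AMON minimum $r$-fold forcing set $B$ for $G$ together with a forcing process starting from $B$ in which at each step either exactly one cluster is forced, or exactly two clusters are forced simultaneously, one being a One cluster and the other a Most cluster (or, when $r=2$, both being One clusters).
   Context: For $r\in\mathbb{N}$, the $r$-blowup $G^{(r)}$ is obtained by replacing each vertex $u$ of $G$ by an independent set $R_u$ of $r$ vertices (a cluster) and each edge $uw$ by all edges between $R_u$ and $R_w$. $r$-fold forcing game: an initial set $B\subseteq V(G^{(r)})$ is blue, the rest white; at each step, with $B_t$ the current blue set, a vertex $u\in B_t$ with $|N(u)\setminus B_t|\le r$ colors all of $N(u)\setminus B_t$ blue. $B$ is an $r$-fold forcing set if repeated application can make all of $G^{(r)}$ blue; it is minimum if it has minimum cardinality among such sets. A cluster is forced at a step if some of its vertices turn from white to blue at that step. Relative to the coloring given by $B$, a cluster is an All cluster (all vertices blue), a Most cluster (for $r\ge3$: exactly $r-1$ vertices blue), a One cluster (exactly one vertex blue), or a None cluster (all white). An AMON $r$-fold forcing set is an $r$-fold forcing set for which every cluster is an All, Most, One, or None cluster. *)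

theory Defs
  imports "Graph_Theory.Pair_Digraph"
begin

text \<open>
  Finite simple graphs are the finite symmetric loop-free digraphs without parallel arcs
  of the locale \<^locale>\<open>pair_graph\<close>: an edge \<open>uw\<close> is the pair of arcs
  \<open>(u, w)\<close> and \<open>(w, u)\<close>. The null graph is allowed.
\<close>

text \<open>The vertex \<open>(u, i)\<close> of the blowup is the \<open>i\<close>-th copy of \<open>u\<close>.\<close>

definition cluster :: "nat \<Rightarrow> 'a \<Rightarrow> ('a \<times> nat) set" where
  "cluster r u = {u} \<times> {..<r}"

definition blowup :: "nat \<Rightarrow> 'a pair_pre_digraph \<Rightarrow> ('a \<times> nat) pair_pre_digraph" where
  "blowup r G =
    \<lparr> pverts = (\<Union>u \<in> pverts G. cluster r u),
      parcs = (\<Union>(u, w) \<in> parcs G. cluster r u \<times> cluster r w) \<rparr>"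

lemma pair_graph_blowup:
  assumes "pair_graph G"
  shows "pair_graph (blowup r G)"
proof -
  interpret G: pair_graph G by fact
  have fin: "finite (cluster r u)" for u :: 'a
    by (simp add: cluster_def)
  have "sym (parcs G)"
    using G.pair_sym_arcs by (simp add: symmetric_def)
  then have sym: "sym (parcs (blowup r G))"
    by (auto simp: sym_def blowup_def cluster_def)
  show ?thesis
  proof
    show "symmetric (with_proj (blowup r G))"
      using sym by (simp add: symmetric_def)
    show "finite (parcs (blowup r G))"
      using G.pair_finite_arcs by (auto simp: blowup_def fin)
  qed (use G.pair_finite_verts in
    \<open>auto simp: blowup_def cluster_def dest: G.in_arcsD1 G.in_arcsD2 G.pair_no_loops\<close>)
qed

abbreviation neighbors :: "'a pair_pre_digraph \<Rightarrow> 'a \<Rightarrow> 'a set" where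
  "neighbors H v \<equiv> parcs H `` {v}"

definition force_step :: "nat \<Rightarrow> 'a pair_pre_digraph \<Rightarrow> 'a set \<Rightarrow> 'a set \<Rightarrow> bool" where
  "force_step r H T T' \<longleftrightarrow>
    (\<exists>v \<in> T. card (neighbors H v - T) \<le> r \<and> T' = T \<union> neighbors H v)"

text \<open>A process is recorded as the list \<open>[B\<^sub>0, \<dots>, B\<^sub>m]\<close> of its successive blue sets;
  its steps are the \<open>m\<close> transitions between consecutive entries.\<close>

definition forcing_process ::
    "nat \<Rightarrow> 'a pair_pre_digraph \<Rightarrow> ('a \<times> nat) set \<Rightarrow> ('a \<times> nat) set list \<Rightarrow> bool" where
  "forcing_process r G B Ts \<longleftrightarrow>
    Ts \<noteq> [] \<and> hd Ts = B \<and> last Ts = pverts (blowup r G) \<and>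
    successively (force_step r (blowup r G)) Ts"

definition forcing_set :: "nat \<Rightarrow> 'a pair_pre_digraph \<Rightarrow> ('a \<times> nat) set \<Rightarrow> bool" where
  "forcing_set r G B \<longleftrightarrow>
    B \<subseteq> pverts (blowup r G) \<and> (\<exists>Ts. forcing_process r G B Ts)"

definition minimum_forcing_set :: "nat \<Rightarrow> 'a pair_pre_digraph \<Rightarrow> ('a \<times> nat) set \<Rightarrow> bool" where
  "minimum_forcing_set r G B \<longleftrightarrow>
    forcing_set r G B \<and> (\<forall>B'. forcing_set r G B' \<longrightarrow> card B \<le> card B')"

text \<open>The type of the cluster of \<open>u\<close> relative to the coloring with blue set \<open>B\<close>.\<close>

definition all_cluster :: "nat \<Rightarrow> ('a \<times> nat) set \<Rightarrow> 'a \<Rightarrow> bool" where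
  "all_cluster r B u \<longleftrightarrow> cluster r u \<subseteq> B"

definition most_cluster :: "nat \<Rightarrow> ('a \<times> nat) set \<Rightarrow> 'a \<Rightarrow> bool" where
  "most_cluster r B u \<longleftrightarrow> 3 \<le> r \<and> card (cluster r u \<inter> B) = r - 1"

definition one_cluster :: "nat \<Rightarrow> ('a \<times> nat) set \<Rightarrow> 'a \<Rightarrow> bool" where
  "one_cluster r B u \<longleftrightarrow> card (cluster r u \<inter> B) = 1"

definition none_cluster :: "nat \<Rightarrow> ('a \<times> nat) set \<Rightarrow> 'a \<Rightarrow> bool" where
  "none_cluster r B u \<longleftrightarrow> cluster r u \<inter> B = {}"

definition AMON :: "nat \<Rightarrow> 'a pair_pre_digraph \<Rightarrow> ('a \<times> nat) set \<Rightarrow> bool" where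
  "AMON r G B \<longleftrightarrow>
    (\<forall>u \<in> pverts G.
      all_cluster r B u \<or> most_cluster r B u \<or> one_cluster r B u \<or> none_cluster r B u)"

text \<open>The clusters forced at the step from \<open>T\<close> to \<open>T'\<close>, each named by its vertex of \<open>G\<close>.\<close>

definition forced_clusters ::
    "nat \<Rightarrow> 'a pair_pre_digraph \<Rightarrow> ('a \<times> nat) set \<Rightarrow> ('a \<times> nat) set \<Rightarrow> 'a set" where
  "forced_clusters r G T T' = {u \<in> pverts G. cluster r u \<inter> (T' - T) \<noteq> {}}"

end

theory Submission
  imports Defs
begin

text \<open>
  Every force fills the white parts of a set \<open>F\<close> of clusters with at most \<open>r\<close> white vertices in
  all, so the white vertices can be redistributed inside \<open>F\<close>, keeping the order of the forces.
  The only constraint is that a cluster of \<open>F\<close> that has already forced needs a blue vertex.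
  If some cluster of \<open>F\<close> has not forced yet, it takes all \<open>r\<close> white vertices (a None cluster).
  Otherwise, if \<open>F\<close> has at least two clusters, one takes \<open>r - 1\<close> white vertices (One) and another
  takes one (Most). If \<open>F\<close> is a single cluster that has already forced, it takes \<open>r - 1\<close> (One).
  All other clusters of \<open>F\<close> become All clusters. No force loses white vertices, so applying this
  to a minimum forcing set gives a minimum forcing set again.
\<close>

text \<open>\<open>B\<close> is kept apart from \<open>T\<close> because types are first read off in
  the current coloring (\<open>B = T\<close>) and only later in the initial one.\<close>

definition amon_step ::
    "nat \<Rightarrow> 'a pair_pre_digraph \<Rightarrow> ('a \<times> nat) set \<Rightarrow> ('a \<times> nat) set \<Rightarrow> ('a \<times> nat) set \<Rightarrow> bool" where
  "amon_step r G B T T' \<longleftrightarrow>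
    (\<exists>u. forced_clusters r G T T' = {u}) \<or>
    (\<exists>u w. u \<noteq> w \<and> forced_clusters r G T T' = {u, w} \<and>
      one_cluster r B u \<and> (most_cluster r B w \<or> r = 2 \<and> one_cluster r B w))"

section \<open>Clusters along a forcing process\<close>

lemma successively_nth:
  "successively P xs \<Longrightarrow> Suc i < length xs \<Longrightarrow> P (xs ! i) (xs ! Suc i)"
proof (induction P xs arbitrary: i rule: successively.induct)
  case (3 P x y xs)
  then show ?case by (cases i) auto
qed auto

lemma neighbors_blowup:
  assumes "i < r"
  shows "neighbors (blowup r G) (u, i) = (\<Union>w \<in> neighbors G u. cluster r w)"
  using assms by (fastforce simp: blowup_def cluster_def)

lemma cluster_subset_blowup: "w \<in> pverts G \<Longrightarrow> cluster r w \<subseteq> pverts (blowup r G)"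
  by (auto simp: blowup_def)

text \<open>A neighborhood in the blowup is a union of clusters, so a force either misses a cluster
  or fills it.\<close>

lemma cluster_Int_force_step:
  assumes "force_step r (blowup r G) T T'" and "T \<subseteq> pverts (blowup r G)"
  shows "cluster r w \<inter> T' = cluster r w \<inter> T \<or> cluster r w \<subseteq> T'"
proof -
  obtain v where v: "v \<in> T" "T' = T \<union> neighbors (blowup r G) v"
    using assms(1) by (auto simp: force_step_def)
  obtain u i where ui: "v = (u, i)" "i < r"
    using v(1) assms(2) by (auto simp: blowup_def cluster_def)
  show ?thesis
    unfolding v(2) ui(1) neighbors_blowup[OF ui(2)] by (auto simp: cluster_def)
qed

lemma force_step_subset:
  assumes "pair_graph G" and "force_step r (blowup r G) T T'" and "T \<subseteq> pverts (blowup r G)"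
  shows "T' \<subseteq> pverts (blowup r G)"
proof -
  interpret H: pair_graph "blowup r G"
    using assms(1) by (rule pair_graph_blowup)
  show ?thesis
    using assms(2,3) by (auto simp: force_step_def dest: H.in_arcsD2)
qed

lemma process_nth_subset:
  assumes "pair_graph G" and "successively (force_step r (blowup r G)) Ts"
    and "hd Ts \<subseteq> pverts (blowup r G)" and "i < length Ts"
  shows "Ts ! i \<subseteq> pverts (blowup r G)"
  using assms(4)
proof (induction i)
  case 0
  then show ?case using assms(3) by (simp add: hd_conv_nth)
next
  case (Suc i)
  then show ?case
    using force_step_subset[OF assms(1)] successively_nth[OF assms(2)] by fastforce
qed

lemma process_cluster_unchanged_or_full:
  assumes "pair_graph G" and "successively (force_step r (blowup r G)) Ts"
    and "hd Ts \<subseteq> pverts (blowup r G)" and "i < length Ts"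
  shows "cluster r w \<inter> Ts ! i = cluster r w \<inter> hd Ts \<or> cluster r w \<subseteq> Ts ! i"
  using assms(4)
proof (induction i)
  case 0
  then show ?case by (simp add: hd_conv_nth)
next
  case (Suc i)
  have step: "force_step r (blowup r G) (Ts ! i) (Ts ! Suc i)"
    using successively_nth[OF assms(2)] Suc.prems by simp
  moreover have "Ts ! i \<subseteq> Ts ! Suc i"
    using step by (auto simp: force_step_def)
  ultimately show ?case
    using cluster_Int_force_step[OF step, of w] Suc
      process_nth_subset[OF assms(1,2,3), of i] by auto
qed

lemma type_cong:
  assumes "cluster r u \<inter> S = cluster r u \<inter> T"
  shows "all_cluster r S u = all_cluster r T u" "most_cluster r S u = most_cluster r T u"
    "one_cluster r S u = one_cluster r T u" "none_cluster r S u = none_cluster r T u"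
  using assms by (auto simp: all_cluster_def most_cluster_def one_cluster_def none_cluster_def)

text \<open>A cluster forced at step \<open>i\<close> is not full just before it, so nothing has
  changed it since the start: its current type is its initial type.\<close>

lemma amon_step_initial:
  assumes "pair_graph G" and "successively (force_step r (blowup r G)) Ts"
    and "hd Ts \<subseteq> pverts (blowup r G)" and "Suc i < length Ts"
    and "amon_step r G (Ts ! i) (Ts ! i) (Ts ! Suc i)"
  shows "amon_step r G (hd Ts) (Ts ! i) (Ts ! Suc i)"
proof -
  have "cluster r u \<inter> Ts ! i = cluster r u \<inter> hd Ts"
    if "u \<in> forced_clusters r G (Ts ! i) (Ts ! Suc i)" for u
    using that process_cluster_unchanged_or_full[OF assms(1-3), of i u] assms(4)
    by (auto simp: forced_clusters_def)
  note eq = type_cong[OF this]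
  show ?thesis
    using assms(5) unfolding amon_step_def by (metis eq(2,3) insertI1 insertI2)
qed

section \<open>Redistributing the white vertices of one force\<close>

text \<open>\<open>W\<close> and \<open>X\<close> are the old and the new set of vertices turned blue by a force of the
  clusters \<open>F\<close>; \<open>S\<close> is the coloring after it, and \<open>U\<close> contains the clusters that have
  already forced.\<close>

lemma redistribute_white:
  fixes W S :: "('a \<times> nat) set" and F U :: "'a set"
  assumes r: "2 \<le> r" and W: "card W \<le> r" "W \<subseteq> (\<Union>w \<in> F. cluster r w)"
    and F: "F \<noteq> {}" "F \<subseteq> pverts G" "(\<Union>w \<in> F. cluster r w) \<subseteq> S"
    and U: "\<And>u. u \<in> U \<Longrightarrow> \<not> cluster r u \<subseteq> W"
    and S: "AMON r G S"
  obtains X where "X \<subseteq> (\<Union>w \<in> F. cluster r w)" "card W \<le> card X" "card X \<le> r"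
    "\<And>u. u \<in> U \<Longrightarrow> (u, 0) \<notin> X" "AMON r G (S - X)" "amon_step r G (S - X) (S - X) S"
proof -
  have fin [simp]: "finite (cluster r w)" and card [simp]: "card (cluster r w) = r" for w :: 'a
    by (auto simp: cluster_def card_cartesian_product)
  \<comment> \<open>Clusters disjoint from \<open>X\<close> inherit their type from
    \<open>S\<close>; only those meeting \<open>X\<close> need a check.\<close>
  have AMON: "AMON r G (S - X)"
    if "\<And>w. w \<in> pverts G \<Longrightarrow> cluster r w \<inter> X \<noteq> {} \<Longrightarrow>
      most_cluster r (S - X) w \<or> one_cluster r (S - X) w \<or> none_cluster r (S - X) w" for X
    unfolding AMON_def
  proof
    fix w assume w: "w \<in> pverts G"
    show "all_cluster r (S - X) w \<or> most_cluster r (S - X) w \<or>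
      one_cluster r (S - X) w \<or> none_cluster r (S - X) w"
    proof (cases "cluster r w \<inter> X = {}")
      case True
      then have "cluster r w \<inter> (S - X) = cluster r w \<inter> S" by auto
      then show ?thesis using S w type_cong[of r w "S - X" S] by (auto simp: AMON_def)
    next
      case False
      then show ?thesis using that w by auto
    qed
  qed
  have forced: "forced_clusters r G (S - X) S = {w \<in> pverts G. cluster r w \<inter> X \<noteq> {}}"
    if "X \<subseteq> (\<Union>w \<in> F. cluster r w)" for X
    using that F(3) by (fastforce simp: forced_clusters_def)
  have meets: "cluster r w \<inter> X \<noteq> {} \<longleftrightarrow> w \<in> fst ` X"
    if "X \<subseteq> (\<Union>w \<in> F. cluster r w)" for X w
    using that by (force simp: cluster_def)
  have full: "cluster r w \<inter> S = cluster r w" if "w \<in> F" for w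
    using that F(3) by auto
  consider x where "x \<in> F - U" | x where "F = {x}" "x \<in> U"
    | x y where "x \<in> F" "y \<in> F" "x \<noteq> y" "F \<subseteq> U"
    using F(1) by (metis DiffI is_singletonI' is_singleton_the_elem subsetI singletonI)
  then show thesis
  proof cases
    case 1
    let ?X = "cluster r x"
    have X: "?X \<subseteq> (\<Union>w \<in> F. cluster r w)"
      using 1 by auto
    have "fst ` ?X = {x}"
      using r by (simp add: cluster_def lessThan_empty_iff)
    then have disj: "cluster r w \<inter> ?X \<noteq> {} \<longleftrightarrow> w = x" for w
      unfolding meets[OF X] by simp
    show thesis
    proof (rule that[OF X])
      show "AMON r G (S - ?X)"
        by (rule AMON) (auto simp: disj none_cluster_def)
      have "forced_clusters r G (S - ?X) S = {x}"
        unfolding forced[OF X] disj using 1 F(2) by auto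
      then show "amon_step r G (S - ?X) (S - ?X) S"
        by (auto simp: amon_step_def)
    qed (use W(1) 1 in \<open>auto simp: cluster_def\<close>)
  next
    case 2
    \<comment> \<open>Copy 0 stays blue, as required for clusters in \<open>U\<close>.\<close>
    let ?X = "{x} \<times> {1..<r}"
    have X: "?X \<subseteq> (\<Union>w \<in> F. cluster r w)"
      using 2 by (auto simp: cluster_def)
    have "fst ` ?X = {x}"
      using r by simp
    then have disj: "cluster r w \<inter> ?X \<noteq> {} \<longleftrightarrow> w = x" for w
      unfolding meets[OF X] by simp
    have "cluster r x \<inter> (S - ?X) = cluster r x - ?X"
      using full[of x] 2(1) by blast
    also have "\<dots> = {(x, 0)}"
      using r by (auto simp: cluster_def)
    finally have one: "one_cluster r (S - ?X) x"
      by (simp add: one_cluster_def)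
    \<comment> \<open>As \<open>x\<close> lies in \<open>U\<close>, its cluster is not contained in
      \<open>W\<close>. So \<open>W\<close> has at most \<open>r - 1\<close> vertices, no more than
      \<open>?X\<close>.\<close>
    have "W \<subset> cluster r x"
      using W(2) 2 U[of x] by auto
    then have "card W < r"
      using psubset_card_mono[of "cluster r x" W] by simp
    show thesis
    proof (rule that[OF X])
      show "AMON r G (S - ?X)"
        by (rule AMON, unfold disj) (use one in blast)
      have "forced_clusters r G (S - ?X) S = {x}"
        unfolding forced[OF X] disj using 2 F(2) by auto
      then show "amon_step r G (S - ?X) (S - ?X) S"
        by (auto simp: amon_step_def)
    qed (use \<open>card W < r\<close> in \<open>auto simp: card_cartesian_product\<close>)
  next
    case 3
    \<comment> \<open>Since \<open>2 \<le> r\<close>, the index \<open>r - 1\<close> is not 0, so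
      \<open>y\<close> keeps its copy 0 blue as well.\<close>
    let ?X = "insert (y, r - 1) ({x} \<times> {1..<r})"
    have X: "?X \<subseteq> (\<Union>w \<in> F. cluster r w)"
      using 3 r by (auto simp: cluster_def)
    have "fst ` ?X = {x, y}"
      using r by (simp add: insert_commute)
    then have disj: "cluster r w \<inter> ?X \<noteq> {} \<longleftrightarrow> w = x \<or> w = y" for w
      unfolding meets[OF X] by simp
    have "cluster r x \<inter> (S - ?X) = cluster r x - ?X"
      using full[of x] 3 by blast
    also have "\<dots> = {(x, 0)}"
      using r \<open>x \<noteq> y\<close> by (auto simp: cluster_def)
    finally have one: "one_cluster r (S - ?X) x"
      by (simp add: one_cluster_def)
    have "cluster r y \<inter> (S - ?X) = cluster r y - ?X"
      using full[of y] 3 by blast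
    also have "\<dots> = cluster r y - {(y, r - 1)}"
      using \<open>x \<noteq> y\<close> by (auto simp: cluster_def)
    finally have "card (cluster r y \<inter> (S - ?X)) = r - 1"
      using r by (simp add: cluster_def card_cartesian_product)
    \<comment> \<open>For \<open>r = 2\<close> the \<open>r - 1\<close> blue vertices are a single
      one, which makes \<open>y\<close> a second One cluster.\<close>
    then have most: "most_cluster r (S - ?X) y \<or> r = 2 \<and> one_cluster r (S - ?X) y"
      using r by (auto simp: most_cluster_def one_cluster_def)
    have card_X: "card ?X = r"
      using r 3 by (simp add: card_cartesian_product)
    show thesis
    proof (rule that[OF X])
      show "AMON r G (S - ?X)"
        by (rule AMON, unfold disj) (use one most in blast)
      have "forced_clusters r G (S - ?X) S = {x, y}"
        unfolding forced[OF X] disj using 3 F(2) by auto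
      then show "amon_step r G (S - ?X) (S - ?X) S"
        unfolding amon_step_def using one most 3(3) by blast
    qed (use W(1) card_X r in auto)
  qed
qed

section \<open>Rebuilding the process from its end\<close>

text \<open>The new process for the tail is extended by a new first coloring. \<open>U\<close>
  collects the clusters that forced at earlier steps; each new force starts from copy 0, so these
  copies must already be blue. Keeping full clusters full ensures that the neighborhood of the
  forcing vertex is blue after the new step.\<close>

lemma amon_process_exists:
  assumes G: "pair_graph G" and r: "2 \<le> r"
  shows "successively (force_step r (blowup r G)) Ts \<Longrightarrow> Ts \<noteq> [] \<Longrightarrow>
    hd Ts \<subseteq> pverts (blowup r G) \<Longrightarrow> last Ts = pverts (blowup r G) \<Longrightarrow>
    (\<And>u. u \<in> U \<Longrightarrow> cluster r u \<inter> hd Ts \<noteq> {}) \<Longrightarrow>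
    \<exists>Ts'. Ts' \<noteq> [] \<and> hd Ts' \<subseteq> pverts (blowup r G) \<and> last Ts' = pverts (blowup r G) \<and>
      card (hd Ts') \<le> card (hd Ts) \<and> AMON r G (hd Ts') \<and>
      (\<forall>u \<in> U. (u, 0) \<in> hd Ts') \<and>
      (\<forall>w. cluster r w \<subseteq> hd Ts \<longrightarrow> cluster r w \<subseteq> hd Ts') \<and>
      successively (\<lambda>T T'. force_step r (blowup r G) T T' \<and> amon_step r G T T T') Ts'"
proof (induction Ts arbitrary: U rule: induct_list012)
  case 1
  then show ?case by simp
next
  case (2 T)
  have "AMON r G T"
    using 2 cluster_subset_blowup[of _ G r] by (auto simp: AMON_def all_cluster_def)
  moreover have "(u, 0) \<in> T" if "u \<in> U" for u
    using 2 that r by (fastforce simp: blowup_def cluster_def)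
  ultimately show ?case
    using 2 by (intro exI[of _ "[T]"]) auto
next
  case (3 T T1 Ts)
  interpret G: pair_graph G by fact
  interpret H: pair_graph "blowup r G" using G by (rule pair_graph_blowup)
  note fin = H.pair_finite_verts
  have T: "T \<subseteq> pverts (blowup r G)" and step: "force_step r (blowup r G) T T1"
    using 3 by auto
  then obtain v where v: "v \<in> T" "card (neighbors (blowup r G) v - T) \<le> r"
      "T1 = T \<union> neighbors (blowup r G) v"
    by (auto simp: force_step_def)
  obtain u i where ui: "v = (u, i)" "i < r"
    using v(1) T by (auto simp: blowup_def cluster_def)
  have nb: "neighbors (blowup r G) (u, j) = (\<Union>w \<in> neighbors G u. cluster r w)" if "j < r" for j
    by (rule neighbors_blowup[OF that])
  define W where "W = T1 - T"
  define F where "F = {w \<in> neighbors G u. cluster r w \<inter> W \<noteq> {}}"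
  have W: "card W \<le> r" "W \<subseteq> (\<Union>w \<in> F. cluster r w)"
    using v nb[OF ui(2)] by (auto simp: W_def F_def ui Un_Diff)
  have T1: "T1 \<subseteq> pverts (blowup r G)"
    using force_step_subset[OF G step T] .
  \<comment> \<open>The blue vertex \<open>v\<close> lies in the cluster of \<open>u\<close>, so
    \<open>u\<close> may join the clusters that have forced.\<close>
  have "cluster r w \<inter> hd (T1 # Ts) \<noteq> {}" if "w \<in> insert u U" for w
    using that 3(7)[of w] v ui by (auto simp: cluster_def)
  moreover have "successively (force_step r (blowup r G)) (T1 # Ts)"
    "last (T1 # Ts) = pverts (blowup r G)"
    using 3(3,6) by auto
  ultimately have "\<exists>Ts'. Ts' \<noteq> [] \<and> hd Ts' \<subseteq> pverts (blowup r G) \<and>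
      last Ts' = pverts (blowup r G) \<and> card (hd Ts') \<le> card T1 \<and> AMON r G (hd Ts') \<and>
      (\<forall>w \<in> insert u U. (w, 0) \<in> hd Ts') \<and>
      (\<forall>w. cluster r w \<subseteq> T1 \<longrightarrow> cluster r w \<subseteq> hd Ts') \<and>
      successively (\<lambda>T T'. force_step r (blowup r G) T T' \<and> amon_step r G T T T') Ts'"
    using 3(2)[of "insert u U"] T1 unfolding list.sel by blast
  then obtain Ts' where Ts': "Ts' \<noteq> []"
      "hd Ts' \<subseteq> pverts (blowup r G)" "last Ts' = pverts (blowup r G)"
      "card (hd Ts') \<le> card T1" "AMON r G (hd Ts')"
      "\<And>w. w \<in> insert u U \<Longrightarrow> (w, 0) \<in> hd Ts'"
      "\<And>w. cluster r w \<subseteq> T1 \<Longrightarrow> cluster r w \<subseteq> hd Ts'"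
      "successively (\<lambda>T T'. force_step r (blowup r G) T T' \<and> amon_step r G T T T') Ts'"
    by blast
  show ?case
  proof (cases "F = {}")
    \<comment> \<open>A force that colors nothing is dropped, since it would force no
      cluster.\<close>
    case True
    then have "T1 = T"
      using W v(3) by (auto simp: W_def)
    then show ?thesis
      using Ts' by (intro exI[of _ Ts']) auto
  next
    case False
    have nbT1: "(\<Union>w \<in> neighbors G u. cluster r w) \<subseteq> T1"
      using nb[OF ui(2)] v(3) by (simp add: ui)
    then have nbS: "(\<Union>w \<in> neighbors G u. cluster r w) \<subseteq> hd Ts'"
      using Ts'(7) by blast
    then have "(\<Union>w \<in> F. cluster r w) \<subseteq> hd Ts'"
      by (auto simp: F_def)
    moreover have "F \<subseteq> pverts G"
      by (auto simp: F_def dest: G.in_arcsD2)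
    moreover have "\<not> cluster r w \<subseteq> W" if "w \<in> U" for w
      using 3(7)[OF that] by (auto simp: W_def)
    ultimately obtain X where X: "X \<subseteq> (\<Union>w \<in> F. cluster r w)" "card W \<le> card X" "card X \<le> r"
      "\<And>u. u \<in> U \<Longrightarrow> (u, 0) \<notin> X" "AMON r G (hd Ts' - X)"
      "amon_step r G (hd Ts' - X) (hd Ts' - X) (hd Ts')"
      using redistribute_white[OF r W False, of G "hd Ts'" U] Ts'(5) by metis
    let ?S = "hd Ts' - X"
    have XN: "X \<subseteq> (\<Union>w \<in> neighbors G u. cluster r w)"
      using X(1) by (auto simp: F_def)
    have XS: "X \<subseteq> hd Ts'"
      using XN nbS by auto
    \<comment> \<open>Without loops, \<open>X\<close> avoids the cluster of \<open>u\<close>, so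
      copy 0 of \<open>u\<close> is blue before the new step and can color exactly
      \<open>X\<close>.\<close>
    have "u \<notin> neighbors G u"
      by (auto dest: G.pair_no_loops)
    then have "(u, 0) \<in> ?S"
      using Ts'(6)[of u] XN by (auto simp: cluster_def)
    moreover have "neighbors (blowup r G) (u, 0) - ?S = X"
      "hd Ts' = ?S \<union> neighbors (blowup r G) (u, 0)"
      using XN nbS nb[of 0] r by auto
    ultimately have "force_step r (blowup r G) ?S (hd Ts')"
      using X(3) unfolding force_step_def by metis
    moreover have "card ?S \<le> card T"
    proof -
      have "card ?S = card (hd Ts') - card X"
        using XS Ts'(2) fin by (simp add: card_Diff_subset finite_subset)
      moreover have "card T = card T1 - card W"
      proof -
        have "T = T1 - W" using v(3) by (auto simp: W_def)
        moreover have "W \<subseteq> T1" by (auto simp: W_def)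
        ultimately show ?thesis
          using T1 fin by (metis card_Diff_subset finite_subset)
      qed
      ultimately show ?thesis
        using Ts'(4) X(2) by linarith
    qed
    \<comment> \<open>A cluster full in \<open>T\<close> does not meet \<open>W\<close>, so it is
      outside \<open>F\<close> and untouched by \<open>X\<close>.\<close>
    moreover have "cluster r w \<subseteq> ?S" if "cluster r w \<subseteq> T" for w
    proof -
      have "w \<notin> F"
        using that by (auto simp: F_def W_def)
      then have "cluster r w \<inter> X = {}"
        using X(1) by (auto simp: cluster_def)
      moreover have "cluster r w \<subseteq> hd Ts'"
        using Ts'(7)[of w] that v(3) by auto
      ultimately show ?thesis by auto
    qed
    ultimately show ?thesis
      using Ts' X by (intro exI[of _ "?S # Ts'"]) (auto simp: successively_Cons)
  qed
qed

section \<open>Starting from a minimum forcing set\<close>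

theorem theorem3p11:
  fixes G :: "'a pair_pre_digraph" and r :: nat
  assumes "pair_graph G" and "2 \<le> r"
  shows "\<exists>B Ts. minimum_forcing_set r G B \<and> AMON r G B \<and> forcing_process r G B Ts \<and>
    (\<forall>i. Suc i < length Ts \<longrightarrow>
      (\<exists>u. forced_clusters r G (Ts ! i) (Ts ! Suc i) = {u}) \<or>
      (\<exists>u w. u \<noteq> w \<and> forced_clusters r G (Ts ! i) (Ts ! Suc i) = {u, w} \<and>
        one_cluster r B u \<and> (most_cluster r B w \<or> r = 2 \<and> one_cluster r B w)))"
proof -
  \<comment> \<open>The full vertex set is forcing by a process without steps, so a minimum
    exists.\<close>
  have "forcing_set r G (pverts (blowup r G))"
    unfolding forcing_set_def forcing_process_def
    by (intro conjI exI[of _ "[pverts (blowup r G)]"]) auto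
  then obtain B where B: "forcing_set r G B" "\<And>B'. forcing_set r G B' \<Longrightarrow> card B \<le> card B'"
    using ex_has_least_nat[of "forcing_set r G" _ card] by blast
  then obtain Ts where "B \<subseteq> pverts (blowup r G)" "forcing_process r G B Ts"
    by (auto simp: forcing_set_def)
  \<comment> \<open>No cluster has forced before the start, hence \<open>U\<close> is empty.\<close>
  then obtain Ts' where Ts': "Ts' \<noteq> []"
      "hd Ts' \<subseteq> pverts (blowup r G)" "last Ts' = pverts (blowup r G)"
      "card (hd Ts') \<le> card B" "AMON r G (hd Ts')"
      "successively (\<lambda>T T'. force_step r (blowup r G) T T' \<and> amon_step r G T T T') Ts'"
    using amon_process_exists[OF assms, of Ts "{}"] by (auto simp: forcing_process_def)
  have succ: "successively (force_step r (blowup r G)) Ts'"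
    using Ts'(6) by (rule successively_mono) auto
  then have process: "forcing_process r G (hd Ts') Ts'"
    using Ts' by (simp add: forcing_process_def)
  then have "minimum_forcing_set r G (hd Ts')"
    using Ts' B(2) le_trans unfolding minimum_forcing_set_def forcing_set_def by blast
  moreover have "amon_step r G (hd Ts') (Ts' ! i) (Ts' ! Suc i)" if "Suc i < length Ts'" for i
    using amon_step_initial[OF assms(1) succ Ts'(2) that] successively_nth[OF Ts'(6) that] by blast
  ultimately show ?thesis
    using process Ts'(5) unfolding amon_step_def by blast
qed

end
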